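(* Let $A,B\in\mathbf{rGr}^{\bullet}$ and let $\beta=(\beta_{+},\beta_{\ast},\beta_{\ast^{\circ}})\colon B\times A\to A$ be a triple of actions of $B$ on $A$ in $\mathbf{rGr}^{\bullet}$, written $\beta_+(b,a)=b\cdot a$, $\beta_\ast(b,a)=a^{b}$, $\beta_{\ast^\circ}(b,a)=b^{a}$. Then the following conditions are equivalent: (1) $\beta$ is a triple of derived actions in $\mathbf{rGr}^{\bullet}$. (2) $\beta_+$ satisfies the group action conditions $b\cdot(a_1+a_2)=b\cdot a_1+b\cdot a_2$, $(b_1+b_2)\cdot a=b_1\cdot(b_2\cdot a)$, $0_B\cdot a=a$ for all $a,a_1,a_2\in A$, $b,b_1,b_2\in B$; the condition $a^{0_B}=a$ holds for all $a\in A$; for all $a,a'\in A$, $b,b'\in B$: $(1_A)$ $(a+a')^{b}=a^{b}+(a')^{b}$, $(2_A)$ $(b+b')^{a}=b^{a}+b\cdot\left((b')^{a}\right)$, $(3_A)$ $(b\cdot a)^{a'}+b^{a'}=b^{a'}+b\cdot\left(a^{a'}\right)$, $(4_A)$ $(b\cdot a)^{b'}=b^{b'}\cdot a^{b'}$, $(1_B)$ $b^{(a+a')}=\left(b^{a}\right)^{a'}+b^{a'}$, $(2_B)$ $a^{b+b'}=\left(a^{b}\right)^{b'}$, $(3_B)$ $\left(a^{(b\cdot a')}\right)^{b}=\left(a^{b}\right)^{a'}$, $(4_B)$ $\left(b^{(b'\cdot a)}\right)^{b'}=\left(b^{b'}\right)^{a}$; and moreover, for all $a,a'\in A$, $b,b'\in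 B$: $$b\cdot a^{a'}=a^{a'},\quad b\cdot a^{b'}=a^{b'},\quad b^{b'}\cdot a=a,\quad b^{(a^{a'})}=b^{a},\quad a^{(b^{b'})}=a^{b},$$ $$a^{b}+a'=a'+a^{b},\quad a^{(a'^{\,b})}=a^{a'},\quad a^{(b^{a'})}=a,\quad b^{(b'^{\,a})}=0_A,\quad b^{(a^{b'})}=b^{a}.$$ (Under these last ten conditions, $(2_A)$, $(3_A)$ and $(4_A)$ have simpler forms.) (3) The semi-direct product $B\ltimes A$ is an object in $\mathbf{rGr}^{\bullet}$.
   Context: Groups are written additively but need not be commutative. An object of the category $\mathbf{Gr}^{\bullet}$ (groups with action on itself) is a group $G$ with a map $G\times G\to G$, $(g,h)\mapsto g^{h}$, such that $g^{g'+g''}=(g^{g'})^{g''}$, $g^{0}=g$ and $(g'+g'')^{g}=g'^{g}+g''^{g}$ for all $g,g',g''\in G$. Morphisms are group homomorphisms $\varphi$ with $\varphi(g^{h})=\varphi(g)^{\varphi(h)}$. $\mathbf{rGr}^{\bullet}$ (reduced groups with action) is the full subcategory of $\mathbf{Gr}^{\bullet}$ of those objects $A$ such that for all $x,y,z\in A$: (i) $x^{y}+z=z+x^{y}$ whenever $y\neq 0$; and (ii) $x^{(y^{z})}=x^{y}$. A triple of actions of $B$ on $A$ is a triple $\beta=(\beta_{+},\beta_{\ast},\beta_{\ast^{\circ}})$ of maps $B\times A\to A$, written $\beta_+(b,a)=b\cdot a$, $\beta_\ast(b,a)=a^{b}$, $\beta_{\ast^\circ}(b,a)=b^{a}$; all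 three values lie in $A$ (so for $a\in A$, $b\in B$ both $a^b$ and $b^a$ are elements of $A$, while $a^{a'}\in A$ and $b^{b'}\in B$ denote the given actions in $A$ and in $B$). $0_A,0_B$ are the zero elements of $A$ and $B$. A split extension of $B$ by $A$ in $\mathbf{rGr}^{\bullet}$ is a sequence $0\to A\xrightarrow{i}E\xrightarrow{p}B\to 0$ in $\mathbf{rGr}^{\bullet}$ (in particular $E\in\mathbf{rGr}^{\bullet}$) with $p$ surjective, $i$ the kernel of $p$, together with a morphism $j\colon B\to E$ with $pj=1_B$. Identifying $i(a)$ with $a$, it induces a triple of actions of $B$ on $A$ by $$b\cdot a=j(b)+a-j(b),\qquad b^{a}=j(b)^{a}-j(b),\qquad a^{b}=a^{j(b)}.$$ A triple of actions is called a triple of derived actions in $\mathbf{rGr}^{\bullet}$ if it is induced in this way by some split extension of $B$ by $A$ in $\mathbf{rGr}^{\bullet}$. Given a triple of actions of $B$ on $A$, the semi-direct product $B\ltimes A$ is the set $B\times A$ with the operations $$(b,a)+(b',a')=(b+b',\,a+b\cdot a'),\qquad (b,a)^{(b',a')}=\left(b^{b'},\,(a^{a'})^{b'}+(b^{a'})^{b'}\right).$$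
   Formalization: Condition (3) is supplemented by 0_A^b = 0_A for all b in B; without it (3) does not imply (1) or (2): for A = B = Z/2 with trivial self-actions, b·a = a, a^b = a+b, b^a = 0, condition (3) holds but (1_A) fails. *)

theory Defs
  imports "HOL-Algebra.Coset"
begin

text \<open>
  The groups are not assumed to be commutative. HOL-Algebra provides noncommutative groups with
  multiplicative notation only, so \<open>g + h\<close>, \<open>0\<close>, \<open>-g\<close> of the additive convention are written
  \<open>g \<otimes> h\<close>, \<open>\<one>\<close>, \<open>inv g\<close>. The action \<open>g\<^sup>h\<close> of a group on itself is written \<open>g \<up> h\<close>.
\<close>

record 'a gract = "'a monoid" +
  act :: "'a \<Rightarrow> 'a \<Rightarrow> 'a" (infixl "\<up>\<index>" 80)

locale group_with_action = group G for G (structure) +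
  assumes act_closed: "\<lbrakk>g \<in> carrier G; h \<in> carrier G\<rbrakk> \<Longrightarrow> g \<up> h \<in> carrier G"
    and act_mult: "\<lbrakk>g \<in> carrier G; g' \<in> carrier G; g'' \<in> carrier G\<rbrakk>
          \<Longrightarrow> g \<up> (g' \<otimes> g'') = (g \<up> g') \<up> g''"
    and act_one: "g \<in> carrier G \<Longrightarrow> g \<up> \<one> = g"
    and mult_act: "\<lbrakk>g \<in> carrier G; g' \<in> carrier G; g'' \<in> carrier G\<rbrakk>
          \<Longrightarrow> (g' \<otimes> g'') \<up> g = (g' \<up> g) \<otimes> (g'' \<up> g)"

locale reduced_group_with_action = group_with_action +
  assumes act_central: "\<lbrakk>x \<in> carrier G; y \<in> carrier G; z \<in> carrier G; y \<noteq> \<one>\<rbrakk>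
          \<Longrightarrow> (x \<up> y) \<otimes> z = z \<otimes> (x \<up> y)"
    and act_act: "\<lbrakk>x \<in> carrier G; y \<in> carrier G; z \<in> carrier G\<rbrakk>
          \<Longrightarrow> x \<up> (y \<up> z) = x \<up> y"

definition gract_hom :: "('a, 'm) gract_scheme \<Rightarrow> ('b, 'n) gract_scheme \<Rightarrow> ('a \<Rightarrow> 'b) set" where
  "gract_hom G H = {\<phi> \<in> hom G H.
     \<forall>g \<in> carrier G. \<forall>h \<in> carrier G. \<phi> (g \<up>\<^bsub>G\<^esub> h) = \<phi> g \<up>\<^bsub>H\<^esub> \<phi> h}"

locale split_extension =
  A: reduced_group_with_action A + E: reduced_group_with_action E + B: reduced_group_with_action B
  for A and E and B +
  fixes i and p and j
  assumes i_hom: "i \<in> gract_hom A E"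
    and p_hom: "p \<in> gract_hom E B"
    and j_hom: "j \<in> gract_hom B E"
    and i_inj: "inj_on i (carrier A)"
    and i_image: "i ` carrier A = kernel E B p"
    and p_surj: "p ` carrier E = carrier B"
    and p_j: "\<And>b. b \<in> carrier B \<Longrightarrow> p (j b) = b"

text \<open>
  A triple of actions of \<open>B\<close> on \<open>A\<close>: \<open>dot b a\<close> is \<open>b \<cdot> a\<close>, \<open>star b a\<close> is \<open>a\<^sup>b\<close>, \<open>circ b a\<close> is \<open>b\<^sup>a\<close>.
  As for all functions between carriers in HOL-Algebra, the values outside the carriers are
  irrelevant.
\<close>

locale action_triple =
  fixes A :: "('a, 'm) gract_scheme" and B :: "('b, 'n) gract_scheme"
    and dot star circ :: "'b \<Rightarrow> 'a \<Rightarrow> 'a"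
  assumes dot_closed: "\<lbrakk>b \<in> carrier B; a \<in> carrier A\<rbrakk> \<Longrightarrow> dot b a \<in> carrier A"
    and star_closed: "\<lbrakk>b \<in> carrier B; a \<in> carrier A\<rbrakk> \<Longrightarrow> star b a \<in> carrier A"
    and circ_closed: "\<lbrakk>b \<in> carrier B; a \<in> carrier A\<rbrakk> \<Longrightarrow> circ b a \<in> carrier A"

definition induces_actions where
  "induces_actions A E B i j dot star circ \<longleftrightarrow>
     (\<forall>b \<in> carrier B. \<forall>a \<in> carrier A.
        i (dot b a) = j b \<otimes>\<^bsub>E\<^esub> i a \<otimes>\<^bsub>E\<^esub> inv\<^bsub>E\<^esub> (j b) \<and>
        i (circ b a) = (j b \<up>\<^bsub>E\<^esub> i a) \<otimes>\<^bsub>E\<^esub> inv\<^bsub>E\<^esub> (j b) \<and>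
        i (star b a) = i a \<up>\<^bsub>E\<^esub> j b)"

text \<open>
  HOL cannot quantify existentially over the type of the elements of \<open>E\<close>. The type \<open>'b \<times> 'a\<close> is
  always large enough: see \<open>derived_actionsI\<close> below.
\<close>

definition derived_actions ::
  "('a, 'm) gract_scheme \<Rightarrow> ('b, 'n) gract_scheme \<Rightarrow>
   ('b \<Rightarrow> 'a \<Rightarrow> 'a) \<Rightarrow> ('b \<Rightarrow> 'a \<Rightarrow> 'a) \<Rightarrow> ('b \<Rightarrow> 'a \<Rightarrow> 'a) \<Rightarrow> bool" where
  "derived_actions A B dot star circ \<longleftrightarrow>
     (\<exists>(E :: ('b \<times> 'a) gract) i p j.
        split_extension A E B i p j \<and> induces_actions A E B i j dot star circ)"

definition transport :: "('e \<Rightarrow> 'f) \<Rightarrow> ('e, 'k) gract_scheme \<Rightarrow> 'f gract" where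
  "transport f E =
     (let g = inv_into (carrier E) f in
      \<lparr>carrier = f ` carrier E,
       mult = (\<lambda>u v. f (g u \<otimes>\<^bsub>E\<^esub> g v)),
       one = f \<one>\<^bsub>E\<^esub>,
       act = (\<lambda>u v. f (g u \<up>\<^bsub>E\<^esub> g v))\<rparr>)"

lemma
  assumes "inj_on f (carrier E)"
  shows transport_carrier: "carrier (transport f E) = f ` carrier E"
    and transport_one: "\<one>\<^bsub>transport f E\<^esub> = f \<one>\<^bsub>E\<^esub>"
    and transport_mult: "\<lbrakk>x \<in> carrier E; y \<in> carrier E\<rbrakk>
          \<Longrightarrow> f x \<otimes>\<^bsub>transport f E\<^esub> f y = f (x \<otimes>\<^bsub>E\<^esub> y)"
    and transport_act: "\<lbrakk>x \<in> carrier E; y \<in> carrier E\<rbrakk>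
          \<Longrightarrow> f x \<up>\<^bsub>transport f E\<^esub> f y = f (x \<up>\<^bsub>E\<^esub> y)"
  using assms by (simp_all add: transport_def Let_def inv_into_f_f)

lemma transport_reduced:
  assumes "reduced_group_with_action E" and inj: "inj_on f (carrier E)"
  shows "reduced_group_with_action (transport f E)"
proof -
  interpret E: reduced_group_with_action E by fact
  note tr = transport_carrier[OF inj] transport_one[OF inj] transport_mult[OF inj]
    transport_act[OF inj]
  have "group (transport f E)"
  proof (rule groupI)
    fix u assume "u \<in> carrier (transport f E)"
    then obtain x where x: "x \<in> carrier E" "u = f x"
      by (auto simp: tr)
    then have "f (inv\<^bsub>E\<^esub> x) \<otimes>\<^bsub>transport f E\<^esub> u = \<one>\<^bsub>transport f E\<^esub>"
      by (simp add: tr)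
    then show "\<exists>v \<in> carrier (transport f E). v \<otimes>\<^bsub>transport f E\<^esub> u = \<one>\<^bsub>transport f E\<^esub>"
      using x by (metis E.inv_closed imageI tr(1))
  qed (auto simp: tr E.m_assoc)
  then interpret T: group "transport f E" .
  show ?thesis
  proof (unfold_locales, goal_cases)
    case (5 x y z)
    then obtain x' y' z' where *: "x' \<in> carrier E" "y' \<in> carrier E" "z' \<in> carrier E"
      "x = f x'" "y = f y'" "z = f z'" by (auto simp: tr)
    with 5 have "y' \<noteq> \<one>\<^bsub>E\<^esub>" by (auto simp: tr)
    with * show ?case by (simp add: tr E.act_closed E.act_central)
  qed (auto simp: tr E.act_closed E.act_mult E.act_one E.mult_act E.act_act)
qed

lemma derived_actionsI:
  fixes E :: "('e, 'k) gract_scheme"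
    and A :: "('a, 'm) gract_scheme" and B :: "('b, 'n) gract_scheme"
  assumes ext: "split_extension A E B i p j"
    and ind: "induces_actions A E B i j dot star circ"
    and triple: "action_triple A B dot star circ"
  shows "derived_actions A B dot star circ"
proof -
  interpret split_extension A E B i p j by fact
  interpret triple: action_triple A B dot star circ by fact
  define f where "f x = (p x, inv_into (carrier A) i (x \<otimes>\<^bsub>E\<^esub> inv\<^bsub>E\<^esub> (j (p x))))" for x
  have i: "i a \<in> carrier E" if "a \<in> carrier A" for a
    using i_hom that by (auto simp: gract_hom_def hom_def)
  have j: "j b \<in> carrier E" if "b \<in> carrier B" for b
    using j_hom that by (auto simp: gract_hom_def hom_def)
  have p: "p x \<in> carrier B" if "x \<in> carrier E" for x
    using p_hom that by (auto simp: gract_hom_def hom_def)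
  have p_group: "group_hom E B p"
    using p_hom by (auto simp: gract_hom_def group_hom_def group_hom_axioms_def)
  have inj: "inj_on f (carrier E)"
  proof
    fix x y assume xy: "x \<in> carrier E" "y \<in> carrier E" "f x = f y"
    have ker: "z \<otimes>\<^bsub>E\<^esub> inv\<^bsub>E\<^esub> (j (p z)) \<in> i ` carrier A" if "z \<in> carrier E" for z
      using that p_group
      by (simp add: i_image kernel_def j p p_j group_hom.hom_mult group_hom.hom_inv)
    have "p x = p y"
      using xy by (simp add: f_def)
    moreover have "x \<otimes>\<^bsub>E\<^esub> inv\<^bsub>E\<^esub> (j (p x)) = y \<otimes>\<^bsub>E\<^esub> inv\<^bsub>E\<^esub> (j (p y))"
      using xy(3) unfolding f_def prod.inject
      by (rule inv_into_injective[OF conjunct2 ker[OF xy(1)] ker[OF xy(2)]])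
    ultimately show "x = y"
      using xy by (simp add: j p)
  qed
  define g where "g = inv_into (carrier E) f"
  have g: "g (f x) = x" if "x \<in> carrier E" for x
    using that inj by (simp add: g_def)
  note tr = transport_carrier[OF inj] transport_one[OF inj] transport_mult[OF inj]
    transport_act[OF inj]
  interpret T: reduced_group_with_action "transport f E"
    by (rule transport_reduced[OF E.reduced_group_with_action_axioms inj])
  have inv: "inv\<^bsub>transport f E\<^esub> (f x) = f (inv\<^bsub>E\<^esub> x)" if "x \<in> carrier E" for x
    by (rule T.inv_equality) (use that in \<open>simp_all add: tr\<close>)
  have "split_extension A (transport f E) B (f \<circ> i) (p \<circ> g) (f \<circ> j)"
  proof unfold_locales
    show "f \<circ> i \<in> gract_hom A (transport f E)"
      using i_hom i by (auto simp: gract_hom_def hom_def tr)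
    show "p \<circ> g \<in> gract_hom (transport f E) B"
      using p_hom by (auto simp: gract_hom_def hom_def tr g E.act_closed)
    show "f \<circ> j \<in> gract_hom B (transport f E)"
      using j_hom j by (auto simp: gract_hom_def hom_def tr)
    show "inj_on (f \<circ> i) (carrier A)"
      using i_inj inj i by (auto intro!: comp_inj_on inj_on_subset[OF inj])
    have "f ` kernel E B p = kernel (transport f E) B (p \<circ> g)"
      by (auto simp: kernel_def tr g)
    then show "(f \<circ> i) ` carrier A = kernel (transport f E) B (p \<circ> g)"
      by (simp only: image_comp[symmetric] i_image)
    show "(p \<circ> g) ` carrier (transport f E) = carrier B"
      using p_surj by (auto simp: tr g image_image)
    show "(p \<circ> g) ((f \<circ> j) b) = b" if "b \<in> carrier B" for b
      using that by (simp add: g j p_j)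
  qed
  moreover have "induces_actions A (transport f E) B (f \<circ> i) (f \<circ> j) dot star circ"
    using ind by (auto simp: induces_actions_def tr inv i j E.act_closed)
  ultimately show ?thesis
    unfolding derived_actions_def by blast
qed

text \<open>
  Only the combination \<open>(a \<up> a')\<^sup>b \<otimes> (b'\<^sup>a')\<^sup>b\<close> enters the action of the semidirect product, so the
  semidirect product does not determine \<open>star\<close> and \<open>circ\<close> for arbitrary maps: for
  \<open>A = B = \<int>/2\<close> with trivial actions on themselves, \<open>b \<cdot> a = a\<close>, \<open>a\<^sup>b = a + b\<close>, \<open>b\<^sup>a = 0\<close> it is
  \<open>\<int>/2 \<times> \<int>/2\<close> with trivial action, although \<open>a \<mapsto> a\<^sup>b\<close> is not additive. The maps are determined once
  \<open>0\<^sup>b = 0\<close> is known for the zero of \<open>A\<close>.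
\<close>

definition semidirect ::
  "('a, 'm) gract_scheme \<Rightarrow> ('b, 'n) gract_scheme \<Rightarrow>
   ('b \<Rightarrow> 'a \<Rightarrow> 'a) \<Rightarrow> ('b \<Rightarrow> 'a \<Rightarrow> 'a) \<Rightarrow> ('b \<Rightarrow> 'a \<Rightarrow> 'a) \<Rightarrow> ('b \<times> 'a) gract" where
  "semidirect A B dot star circ =
     \<lparr>carrier = carrier B \<times> carrier A,
      mult = (\<lambda>(b, a) (b', a'). (b \<otimes>\<^bsub>B\<^esub> b', a \<otimes>\<^bsub>A\<^esub> dot b a')),
      one = (\<one>\<^bsub>B\<^esub>, \<one>\<^bsub>A\<^esub>),
      act = (\<lambda>(b, a) (b', a').
        (b \<up>\<^bsub>B\<^esub> b', star b' (a \<up>\<^bsub>A\<^esub> a') \<otimes>\<^bsub>A\<^esub> star b' (circ b a')))\<rparr>"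

definition derived_action_conditions ::
  "('a, 'm) gract_scheme \<Rightarrow> ('b, 'n) gract_scheme \<Rightarrow>
   ('b \<Rightarrow> 'a \<Rightarrow> 'a) \<Rightarrow> ('b \<Rightarrow> 'a \<Rightarrow> 'a) \<Rightarrow> ('b \<Rightarrow> 'a \<Rightarrow> 'a) \<Rightarrow> bool" where
  "derived_action_conditions A B dot star circ \<longleftrightarrow>
     (\<forall>b \<in> carrier B. \<forall>a\<^sub>1 \<in> carrier A. \<forall>a\<^sub>2 \<in> carrier A.
        dot b (a\<^sub>1 \<otimes>\<^bsub>A\<^esub> a\<^sub>2) = dot b a\<^sub>1 \<otimes>\<^bsub>A\<^esub> dot b a\<^sub>2) \<and>
     (\<forall>b\<^sub>1 \<in> carrier B. \<forall>b\<^sub>2 \<in> carrier B. \<forall>a \<in> carrier A.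
        dot (b\<^sub>1 \<otimes>\<^bsub>B\<^esub> b\<^sub>2) a = dot b\<^sub>1 (dot b\<^sub>2 a)) \<and>
     (\<forall>a \<in> carrier A. dot \<one>\<^bsub>B\<^esub> a = a) \<and>
     (\<forall>a \<in> carrier A. star \<one>\<^bsub>B\<^esub> a = a) \<and>
     (\<forall>a \<in> carrier A. \<forall>a' \<in> carrier A. \<forall>b \<in> carrier B. \<forall>b' \<in> carrier B.
        \<comment> \<open>\<open>1\<^sub>A\<close> to \<open>4\<^sub>A\<close>\<close>
        star b (a \<otimes>\<^bsub>A\<^esub> a') = star b a \<otimes>\<^bsub>A\<^esub> star b a' \<and>
        circ (b \<otimes>\<^bsub>B\<^esub> b') a = circ b a \<otimes>\<^bsub>A\<^esub> dot b (circ b' a) \<and>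
        (dot b a \<up>\<^bsub>A\<^esub> a') \<otimes>\<^bsub>A\<^esub> circ b a' = circ b a' \<otimes>\<^bsub>A\<^esub> dot b (a \<up>\<^bsub>A\<^esub> a') \<and>
        star b' (dot b a) = dot (b \<up>\<^bsub>B\<^esub> b') (star b' a) \<and>
        \<comment> \<open>\<open>1\<^sub>B\<close> to \<open>4\<^sub>B\<close>\<close>
        circ b (a \<otimes>\<^bsub>A\<^esub> a') = (circ b a \<up>\<^bsub>A\<^esub> a') \<otimes>\<^bsub>A\<^esub> circ b a' \<and>
        star (b \<otimes>\<^bsub>B\<^esub> b') a = star b' (star b a) \<and>
        star b (a \<up>\<^bsub>A\<^esub> dot b a') = star b a \<up>\<^bsub>A\<^esub> a' \<and>
        star b' (circ b (dot b' a)) = circ (b \<up>\<^bsub>B\<^esub> b') a \<and>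
        \<comment> \<open>the ten further conditions specific to the reduced case\<close>
        dot b (a \<up>\<^bsub>A\<^esub> a') = a \<up>\<^bsub>A\<^esub> a' \<and>
        dot b (star b' a) = star b' a \<and>
        dot (b \<up>\<^bsub>B\<^esub> b') a = a \<and>
        circ b (a \<up>\<^bsub>A\<^esub> a') = circ b a \<and>
        star (b \<up>\<^bsub>B\<^esub> b') a = star b a \<and>
        star b a \<otimes>\<^bsub>A\<^esub> a' = a' \<otimes>\<^bsub>A\<^esub> star b a \<and>
        a \<up>\<^bsub>A\<^esub> star b a' = a \<up>\<^bsub>A\<^esub> a' \<and>
        a \<up>\<^bsub>A\<^esub> circ b a' = a \<and>
        circ b (circ b' a) = \<one>\<^bsub>A\<^esub> \<and>
        circ b (star b' a) = circ b a)"

end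

theory Submission
  imports Defs
begin

text \<open>
  The axioms of a reduced group with action force commutativity. Every \<open>x \<mapsto> x \<up> y\<close> is a bijection,
  with inverse \<open>x \<mapsto> x \<up> (inv y)\<close>; so as soon as some \<open>y \<noteq> \<one>\<close> exists, every element has the form
  \<open>x \<up> y\<close> with \<open>y \<noteq> \<one>\<close> and is central. Hence \<open>A\<close>, \<open>B\<close> and the middle group of every split extension
  are abelian, and the conjugation action \<open>dot\<close> is trivial.

  The three conditions are then linked in a cycle.

  Conditions from a split extension (\<open>split_extension_conditions\<close>): the embedding \<open>i\<close> carries each
  condition to an identity in the abelian group \<open>E\<close> between expressions in the \<open>i a\<close> and \<open>j b\<close>. Besides
  the axioms, two of their consequences are used to verify these: actions of different elements commute, because
  \<open>y \<otimes> z = z \<otimes> y\<close>, and an element \<open>(y \<up> z) \<otimes> inv y\<close> acts trivially, because \<open>y \<up> z\<close> acts as \<open>y\<close>.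
  The latter explains why the elements \<open>circ b a\<close> act trivially.

  Semidirect product from the conditions (\<open>conditions_semidirect\<close>): with \<open>dot\<close> trivial, the underlying
  group is the direct product of two abelian groups, and the axioms for the action follow
  componentwise.

  Split extension from the semidirect product (\<open>semidirect_derived_actions\<close>): the maps
  \<open>a \<mapsto> (\<one>, a)\<close>, \<open>fst\<close> and \<open>b \<mapsto> (b, \<one>)\<close> form a split extension. It induces the given triple because
  \<open>star b \<one> = \<one>\<close> allows the two summands in the action of the semidirect product to be separated.
\<close>

section \<open>Reduced groups with action are abelian\<close>

context group_with_action
begin

lemma one_act:
  assumes "g \<in> carrier G"
  shows "\<one> \<up> g = \<one>"
  using mult_act[of g \<one> \<one>] assms by (simp add: act_closed)

lemma inv_act:
  assumes "x \<in> carrier G" "g \<in> carrier G"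
  shows "(inv x) \<up> g = inv (x \<up> g)"
proof -
  have "((inv x) \<up> g) \<otimes> (x \<up> g) = \<one>"
    using mult_act[of g "inv x" x] assms by (simp add: one_act)
  then show ?thesis
    using assms inv_equality by (simp add: act_closed)
qed

lemma act_inv_act:
  assumes "x \<in> carrier G" "y \<in> carrier G"
  shows "(x \<up> (inv y)) \<up> y = x" "(x \<up> y) \<up> (inv y) = x"
  using act_mult[of x "inv y" y] act_mult[of x y "inv y"] assms by (simp_all add: act_one)

end

context reduced_group_with_action
begin

text \<open>
  For \<open>y \<noteq> \<one>\<close> every \<open>x\<close> equals \<open>(x \<up> (inv y)) \<up> y\<close> and is therefore central.
\<close>

lemma mult_commute:
  assumes "x \<in> carrier G" "y \<in> carrier G"
  shows "x \<otimes> y = y \<otimes> x"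
proof (cases "y = \<one>")
  case False
  then show ?thesis
    using act_central[of "x \<up> (inv y)" y y] assms by (simp add: act_closed act_inv_act)
qed (use assms in simp)

lemma comm_group: "comm_group G"
  by (rule group_comm_groupI) (rule mult_commute)

lemma act_commute:
  assumes "x \<in> carrier G" "y \<in> carrier G" "z \<in> carrier G"
  shows "(x \<up> y) \<up> z = (x \<up> z) \<up> y"
  using act_mult[of x y z] act_mult[of x z y] mult_commute[of y z] assms by simp

text \<open>
  An element and its images under the action act in the same way, so their quotient acts trivially.
\<close>

lemma act_displacement:
  assumes "x \<in> carrier G" "y \<in> carrier G" "z \<in> carrier G"
  shows "x \<up> ((y \<up> z) \<otimes> inv y) = x"
  using assms by (simp add: act_mult act_closed act_act act_inv_act)

end

section \<open>Conditions satisfied by derived actions\<close>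

text \<open>
  In the abelian group \<open>E\<close> conjugation is trivial, so \<open>dot b a = a\<close>; the other conditions are
  checked after applying the injective map \<open>i\<close>.
\<close>

lemma split_extension_conditions:
  assumes ext: "split_extension A E B i p j"
    and ind: "induces_actions A E B i j dot star circ"
    and triple: "action_triple A B dot star circ"
  shows "derived_action_conditions A B dot star circ"
proof -
  interpret split_extension A E B i p j by fact
  interpret triple: action_triple A B dot star circ by fact
  interpret EC: comm_group E by (rule E.comm_group)
  have i: "i a \<in> carrier E" if "a \<in> carrier A" for a
    using i_hom that by (auto simp: gract_hom_def hom_def)
  have j: "j b \<in> carrier E" if "b \<in> carrier B" for b
    using j_hom that by (auto simp: gract_hom_def hom_def)
  have i_mult: "i (a \<otimes>\<^bsub>A\<^esub> a') = i a \<otimes>\<^bsub>E\<^esub> i a'"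
    and i_act: "i (a \<up>\<^bsub>A\<^esub> a') = i a \<up>\<^bsub>E\<^esub> i a'"
    if "a \<in> carrier A" "a' \<in> carrier A" for a a'
    using i_hom that by (auto simp: gract_hom_def hom_def)
  have j_mult: "j (b \<otimes>\<^bsub>B\<^esub> b') = j b \<otimes>\<^bsub>E\<^esub> j b'"
    and j_act: "j (b \<up>\<^bsub>B\<^esub> b') = j b \<up>\<^bsub>E\<^esub> j b'"
    if "b \<in> carrier B" "b' \<in> carrier B" for b b'
    using j_hom that by (auto simp: gract_hom_def hom_def)
  have i_one: "i \<one>\<^bsub>A\<^esub> = \<one>\<^bsub>E\<^esub>"
    using i_mult[of "\<one>\<^bsub>A\<^esub>" "\<one>\<^bsub>A\<^esub>"] by (simp add: i)
  have j_one: "j \<one>\<^bsub>B\<^esub> = \<one>\<^bsub>E\<^esub>"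
    using j_mult[of "\<one>\<^bsub>B\<^esub>" "\<one>\<^bsub>B\<^esub>"] by (simp add: j)
  have i_star: "i (star b a) = i a \<up>\<^bsub>E\<^esub> j b"
    and i_circ: "i (circ b a) = (j b \<up>\<^bsub>E\<^esub> i a) \<otimes>\<^bsub>E\<^esub> inv\<^bsub>E\<^esub> (j b)"
    if "a \<in> carrier A" "b \<in> carrier B" for a b
    using ind that by (simp_all add: induces_actions_def)
  have i_eqD: "a = a'" if "i a = i a'" "a \<in> carrier A" "a' \<in> carrier A" for a a'
    using i_inj that by (simp add: inj_on_eq_iff)
  have dot: "dot b a = a" if "a \<in> carrier A" "b \<in> carrier B" for a b
  proof (rule i_eqD)
    have "i (dot b a) = j b \<otimes>\<^bsub>E\<^esub> i a \<otimes>\<^bsub>E\<^esub> inv\<^bsub>E\<^esub> j b"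
      using ind that by (simp add: induces_actions_def)
    then show "i (dot b a) = i a"
      using that E.mult_commute[of "j b" "i a"] by (simp add: i j E.m_assoc)
  qed (use that in \<open>simp_all add: triple.dot_closed\<close>)
  \<comment> \<open>\<open>j b \<up> i a\<close> as a product of elements of the two factors, so that identities for \<open>circ\<close> can be
    shown without inverses, by cancelling \<open>j b\<close>.\<close>
  have circ_j: "i (circ b a) \<otimes>\<^bsub>E\<^esub> j b = j b \<up>\<^bsub>E\<^esub> i a" if "a \<in> carrier A" "b \<in> carrier B" for a b
    using that by (simp add: i_circ i j E.m_assoc E.act_closed)
  have circ_trivial: "x \<up>\<^bsub>E\<^esub> i (circ b a) = x"
    if "x \<in> carrier E" "a \<in> carrier A" "b \<in> carrier B" for x a b
    using that by (simp add: i_circ i j E.act_displacement)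
  note closed = i j E.act_closed A.act_closed B.act_closed triple.star_closed triple.circ_closed
  note i_simps = i_mult i_act j_mult j_act i_star closed
  have circ_mult_left: "circ (b \<otimes>\<^bsub>B\<^esub> b') a = circ b a \<otimes>\<^bsub>A\<^esub> circ b' a"
    if "a \<in> carrier A" "b \<in> carrier B" "b' \<in> carrier B" for a b b'
    by (rule i_eqD) (use that in \<open>simp_all add: i_simps i_circ E.mult_act EC.inv_mult EC.m_ac\<close>)
  have circ_mult_right: "circ b (a \<otimes>\<^bsub>A\<^esub> a') = (circ b a \<up>\<^bsub>A\<^esub> a') \<otimes>\<^bsub>A\<^esub> circ b a'"
    if "a \<in> carrier A" "a' \<in> carrier A" "b \<in> carrier B" for a a' b
  proof (rule i_eqD)
    have "i (circ b (a \<otimes>\<^bsub>A\<^esub> a')) \<otimes>\<^bsub>E\<^esub> j b = (j b \<up>\<^bsub>E\<^esub> i a) \<up>\<^bsub>E\<^esub> i a'"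
      using that by (simp add: circ_j i_simps E.act_mult)
    also have "\<dots> = (i (circ b a) \<otimes>\<^bsub>E\<^esub> j b) \<up>\<^bsub>E\<^esub> i a'"
      using that by (simp only: circ_j)
    also have "\<dots> = (i (circ b a) \<up>\<^bsub>E\<^esub> i a') \<otimes>\<^bsub>E\<^esub> (i (circ b a') \<otimes>\<^bsub>E\<^esub> j b)"
      unfolding circ_j[OF that(2,3)] using that by (simp add: E.mult_act closed)
    also have "\<dots> = i ((circ b a \<up>\<^bsub>A\<^esub> a') \<otimes>\<^bsub>A\<^esub> circ b a') \<otimes>\<^bsub>E\<^esub> j b"
      using that by (simp add: i_simps E.m_assoc)
    finally show "i (circ b (a \<otimes>\<^bsub>A\<^esub> a')) = i ((circ b a \<up>\<^bsub>A\<^esub> a') \<otimes>\<^bsub>A\<^esub> circ b a')"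
      using that by (simp add: closed)
  qed (use that in \<open>simp_all add: closed\<close>)
  have star_act: "star b (a \<up>\<^bsub>A\<^esub> a') = star b a \<up>\<^bsub>A\<^esub> a'"
    if "a \<in> carrier A" "a' \<in> carrier A" "b \<in> carrier B" for a a' b
    by (rule i_eqD) (use that in \<open>simp_all add: i_simps E.act_commute[of "i a" "i a'"]\<close>)
  have star_circ: "star b' (circ b a) = circ (b \<up>\<^bsub>B\<^esub> b') a"
    if "a \<in> carrier A" "b \<in> carrier B" "b' \<in> carrier B" for a b b'
    by (rule i_eqD) (use that in \<open>simp_all add: i_simps i_circ E.mult_act E.inv_act
          E.act_commute[of "j b" "i a"]\<close>)
  have star_one: "star \<one>\<^bsub>B\<^esub> a = a" if "a \<in> carrier A" for a
    by (rule i_eqD) (use that in \<open>simp_all add: i_simps j_one E.act_one\<close>)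
  have star_mult: "star b (a \<otimes>\<^bsub>A\<^esub> a') = star b a \<otimes>\<^bsub>A\<^esub> star b a'"
    if "a \<in> carrier A" "a' \<in> carrier A" "b \<in> carrier B" for a a' b
    by (rule i_eqD) (use that in \<open>simp_all add: i_simps E.mult_act\<close>)
  have mult_star: "star (b \<otimes>\<^bsub>B\<^esub> b') a = star b' (star b a)"
    if "a \<in> carrier A" "b \<in> carrier B" "b' \<in> carrier B" for a b b'
    by (rule i_eqD) (use that in \<open>simp_all add: i_simps E.act_mult\<close>)
  have circ_act: "circ b (a \<up>\<^bsub>A\<^esub> a') = circ b a"
    if "a \<in> carrier A" "a' \<in> carrier A" "b \<in> carrier B" for a a' b
    by (rule i_eqD) (use that in \<open>simp_all add: i_simps i_circ E.act_act\<close>)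
  have star_by_act: "star (b \<up>\<^bsub>B\<^esub> b') a = star b a"
    if "a \<in> carrier A" "b \<in> carrier B" "b' \<in> carrier B" for a b b'
    by (rule i_eqD) (use that in \<open>simp_all add: i_simps E.act_act\<close>)
  have act_star: "a \<up>\<^bsub>A\<^esub> star b a' = a \<up>\<^bsub>A\<^esub> a'"
    if "a \<in> carrier A" "a' \<in> carrier A" "b \<in> carrier B" for a a' b
    by (rule i_eqD) (use that in \<open>simp_all add: i_simps E.act_act\<close>)
  have act_circ: "a \<up>\<^bsub>A\<^esub> circ b a' = a"
    if "a \<in> carrier A" "a' \<in> carrier A" "b \<in> carrier B" for a a' b
    by (rule i_eqD) (use that in \<open>simp_all add: i_simps circ_trivial\<close>)
  have circ_circ: "circ b (circ b' a) = \<one>\<^bsub>A\<^esub>"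
    if "a \<in> carrier A" "b \<in> carrier B" "b' \<in> carrier B" for a b b'
  proof (rule i_eqD)
    show "i (circ b (circ b' a)) = i \<one>\<^bsub>A\<^esub>"
      using that by (simp add: i_circ[of "circ b' a" b] circ_trivial closed i_one)
  qed (use that in \<open>simp_all add: closed\<close>)
  have circ_star: "circ b (star b' a) = circ b a"
    if "a \<in> carrier A" "b \<in> carrier B" "b' \<in> carrier B" for a b b'
    by (rule i_eqD) (use that in \<open>simp_all add: i_simps i_circ E.act_act\<close>)
  show ?thesis
    unfolding derived_action_conditions_def
    by (intro conjI ballI)
      (simp_all add: dot closed star_one star_mult mult_star circ_mult_left circ_mult_right
        star_act star_circ circ_act act_star star_by_act act_circ circ_circ circ_star
        A.mult_commute)
qed

section \<open>The semidirect product\<close>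

lemma semidirect_simps:
  "carrier (semidirect A B dot star circ) = carrier B \<times> carrier A"
  "\<one>\<^bsub>semidirect A B dot star circ\<^esub> = (\<one>\<^bsub>B\<^esub>, \<one>\<^bsub>A\<^esub>)"
  "(b, a) \<otimes>\<^bsub>semidirect A B dot star circ\<^esub> (b', a') = (b \<otimes>\<^bsub>B\<^esub> b', a \<otimes>\<^bsub>A\<^esub> dot b a')"
  "(b, a) \<up>\<^bsub>semidirect A B dot star circ\<^esub> (b', a') =
     (b \<up>\<^bsub>B\<^esub> b', star b' (a \<up>\<^bsub>A\<^esub> a') \<otimes>\<^bsub>A\<^esub> star b' (circ b a'))"
  by (simp_all add: semidirect_def)

text \<open>
  Taking \<open>a' = \<one>\<close> in \<open>b \<cdot> (a \<up> a') = a \<up> a'\<close> shows that \<open>dot\<close> is trivial. For the reducedness of the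
  action, note that \<open>(b', a') \<up> (b'', a'')\<close> has a second component \<open>u \<otimes> v\<close> in which \<open>u\<close> acts as \<open>a'\<close>
  and \<open>v = star b'' (circ b' a'')\<close> acts trivially.
\<close>

lemma conditions_semidirect:
  assumes A: "reduced_group_with_action A"
    and B: "reduced_group_with_action B"
    and triple: "action_triple A B dot star circ"
    and cond: "derived_action_conditions A B dot star circ"
  shows "reduced_group_with_action (semidirect A B dot star circ)"
    and "\<And>b. b \<in> carrier B \<Longrightarrow> star b \<one>\<^bsub>A\<^esub> = \<one>\<^bsub>A\<^esub>"
proof -
  interpret A: reduced_group_with_action A by fact
  interpret B: reduced_group_with_action B by fact
  interpret triple: action_triple A B dot star circ by fact
  interpret AC: comm_group A by (rule A.comm_group)
  let ?E = "semidirect A B dot star circ"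
  note closed = triple.star_closed triple.circ_closed A.act_closed B.act_closed
  note c = cond[unfolded derived_action_conditions_def]
  have dot: "dot b a = a" if "a \<in> carrier A" "b \<in> carrier B" for a b
  proof -
    have "dot b (a \<up>\<^bsub>A\<^esub> \<one>\<^bsub>A\<^esub>) = a \<up>\<^bsub>A\<^esub> \<one>\<^bsub>A\<^esub>"
      using c that A.one_closed by blast
    then show ?thesis
      using that by (simp add: A.act_one)
  qed
  have star_one: "star \<one>\<^bsub>B\<^esub> a = a" if "a \<in> carrier A" for a
    using c that by blast
  have star_mult: "star b (a \<otimes>\<^bsub>A\<^esub> a') = star b a \<otimes>\<^bsub>A\<^esub> star b a'"
    and circ_mult_right: "circ b (a \<otimes>\<^bsub>A\<^esub> a') = (circ b a \<up>\<^bsub>A\<^esub> a') \<otimes>\<^bsub>A\<^esub> circ b a'"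
    and circ_act: "circ b (a \<up>\<^bsub>A\<^esub> a') = circ b a"
    and act_star: "a \<up>\<^bsub>A\<^esub> star b a' = a \<up>\<^bsub>A\<^esub> a'"
    and act_circ: "a \<up>\<^bsub>A\<^esub> circ b a' = a"
    if "a \<in> carrier A" "a' \<in> carrier A" "b \<in> carrier B" for a a' b
    using c that by blast+
  have star_act: "star b (a \<up>\<^bsub>A\<^esub> a') = star b a \<up>\<^bsub>A\<^esub> a'"
    if "a \<in> carrier A" "a' \<in> carrier A" "b \<in> carrier B" for a a' b
  proof -
    have "star b (a \<up>\<^bsub>A\<^esub> dot b a') = star b a \<up>\<^bsub>A\<^esub> a'"
      using c that by blast
    then show ?thesis
      using that by (simp add: dot)
  qed
  have mult_star: "star (b \<otimes>\<^bsub>B\<^esub> b') a = star b' (star b a)"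
    and star_by_act: "star (b \<up>\<^bsub>B\<^esub> b') a = star b a"
    and circ_circ: "circ b (circ b' a) = \<one>\<^bsub>A\<^esub>"
    and circ_star: "circ b (star b' a) = circ b a"
    and circ_mult_left': "circ (b \<otimes>\<^bsub>B\<^esub> b') a = circ b a \<otimes>\<^bsub>A\<^esub> dot b (circ b' a)"
    and star_circ': "star b' (circ b (dot b' a)) = circ (b \<up>\<^bsub>B\<^esub> b') a"
    if "a \<in> carrier A" "b \<in> carrier B" "b' \<in> carrier B" for a b b'
    using c that by blast+
  have circ_mult_left: "circ (b \<otimes>\<^bsub>B\<^esub> b') a = circ b a \<otimes>\<^bsub>A\<^esub> circ b' a"
    and star_circ: "circ (b \<up>\<^bsub>B\<^esub> b') a = star b' (circ b a)"
    if "a \<in> carrier A" "b \<in> carrier B" "b' \<in> carrier B" for a b b'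
    using that circ_mult_left'[of a b b'] star_circ'[of a b b'] by (simp_all add: dot closed)
  show star_unit: "star b \<one>\<^bsub>A\<^esub> = \<one>\<^bsub>A\<^esub>" if "b \<in> carrier B" for b
    using star_mult[of "\<one>\<^bsub>A\<^esub>" "\<one>\<^bsub>A\<^esub>" b] that by (simp add: closed)
  have circ_unit: "circ b \<one>\<^bsub>A\<^esub> = \<one>\<^bsub>A\<^esub>" if "b \<in> carrier B" for b
    using circ_mult_right[of "\<one>\<^bsub>A\<^esub>" "\<one>\<^bsub>A\<^esub>" b] that by (simp add: closed A.act_one)
  note simps = semidirect_simps dot closed
  have "group ?E"
  proof (rule groupI)
    fix x assume "x \<in> carrier ?E"
    then obtain b a where x: "x = (b, a)" "b \<in> carrier B" "a \<in> carrier A"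
      by (auto simp: simps)
    then show "\<exists>y \<in> carrier ?E. y \<otimes>\<^bsub>?E\<^esub> x = \<one>\<^bsub>?E\<^esub>"
      by (intro bexI[of _ "(inv\<^bsub>B\<^esub> b, inv\<^bsub>A\<^esub> a)"]) (simp_all add: simps)
  qed (auto simp: simps A.m_assoc B.m_assoc)
  then interpret E: group ?E .
  show "reduced_group_with_action ?E"
  proof unfold_locales
    fix x y assume "x \<in> carrier ?E" "y \<in> carrier ?E"
    then show "x \<up>\<^bsub>?E\<^esub> y \<in> carrier ?E"
      by (auto simp: simps)
  next
    fix x y z assume "x \<in> carrier ?E" "y \<in> carrier ?E" "z \<in> carrier ?E"
    then show "x \<up>\<^bsub>?E\<^esub> (y \<otimes>\<^bsub>?E\<^esub> z) = (x \<up>\<^bsub>?E\<^esub> y) \<up>\<^bsub>?E\<^esub> z"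
      by (auto simp: simps A.act_mult B.act_mult A.mult_act mult_star circ_mult_right star_mult
          star_act star_circ A.m_assoc)
  next
    fix x assume "x \<in> carrier ?E"
    then show "x \<up>\<^bsub>?E\<^esub> \<one>\<^bsub>?E\<^esub> = x"
      by (auto simp: simps A.act_one B.act_one circ_unit star_one)
  next
    fix x y z assume "z \<in> carrier ?E" "x \<in> carrier ?E" "y \<in> carrier ?E"
    then show "(x \<otimes>\<^bsub>?E\<^esub> y) \<up>\<^bsub>?E\<^esub> z = (x \<up>\<^bsub>?E\<^esub> z) \<otimes>\<^bsub>?E\<^esub> (y \<up>\<^bsub>?E\<^esub> z)"
      by (auto simp: simps A.mult_act B.mult_act circ_mult_left star_mult AC.m_ac)
  next
    fix x y z assume "x \<in> carrier ?E" "y \<in> carrier ?E" "z \<in> carrier ?E"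
    then show "(x \<up>\<^bsub>?E\<^esub> y) \<otimes>\<^bsub>?E\<^esub> z = z \<otimes>\<^bsub>?E\<^esub> (x \<up>\<^bsub>?E\<^esub> y)"
      by (auto simp: simps A.mult_commute B.mult_commute)
  next
    fix x y z assume "x \<in> carrier ?E" "y \<in> carrier ?E" "z \<in> carrier ?E"
    then show "x \<up>\<^bsub>?E\<^esub> (y \<up>\<^bsub>?E\<^esub> z) = x \<up>\<^bsub>?E\<^esub> y"
      by (auto simp: simps B.act_act A.act_mult A.act_act act_star act_circ star_by_act
          circ_mult_right circ_star circ_circ circ_act)
  qed
qed

text \<open>
  The unit laws of the semidirect product give \<open>\<one> \<cdot> a = a\<close> and \<open>b \<cdot> \<one> = \<one>\<close>. As \<open>star b \<one> = \<one>\<close>, the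
  laws \<open>x \<up> \<one> = x\<close> and \<open>\<one> \<up> x = \<one>\<close> give the normalisations of \<open>star\<close> and \<open>circ\<close> at the units, and with
  these each of \<open>dot\<close>, \<open>star\<close>, \<open>circ\<close> can be read off from operations on the elements
  \<open>(\<one>, a)\<close> and \<open>(b, \<one>)\<close>.
\<close>

lemma semidirect_derived_actions:
  fixes A :: "('a, 'm) gract_scheme" and B :: "('b, 'n) gract_scheme"
  assumes A: "reduced_group_with_action A"
    and B: "reduced_group_with_action B"
    and triple: "action_triple A B dot star circ"
    and E: "reduced_group_with_action (semidirect A B dot star circ)"
    and star_unit: "\<And>b. b \<in> carrier B \<Longrightarrow> star b \<one>\<^bsub>A\<^esub> = \<one>\<^bsub>A\<^esub>"
  shows "derived_actions A B dot star circ"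
proof -
  interpret A: reduced_group_with_action A by fact
  interpret B: reduced_group_with_action B by fact
  interpret triple: action_triple A B dot star circ by fact
  let ?E = "semidirect A B dot star circ"
  interpret E: reduced_group_with_action ?E by fact
  note closed = triple.star_closed triple.circ_closed triple.dot_closed A.act_closed B.act_closed
  have one_dot: "dot \<one>\<^bsub>B\<^esub> a = a" if "a \<in> carrier A" for a
    using E.l_one[of "(\<one>\<^bsub>B\<^esub>, a)"] that by (simp add: semidirect_simps closed)
  have dot_one: "dot b \<one>\<^bsub>A\<^esub> = \<one>\<^bsub>A\<^esub>" if "b \<in> carrier B" for b
    using E.r_one[of "(b, \<one>\<^bsub>A\<^esub>)"] that by (simp add: semidirect_simps closed)
  have star_circ_one: "star \<one>\<^bsub>B\<^esub> (circ b \<one>\<^bsub>A\<^esub>) = \<one>\<^bsub>A\<^esub>" if "b \<in> carrier B" for b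
    using E.act_one[of "(b, \<one>\<^bsub>A\<^esub>)"] that
    by (simp add: semidirect_simps closed A.act_one star_unit)
  have star_one: "star \<one>\<^bsub>B\<^esub> a = a" if "a \<in> carrier A" for a
    using E.act_one[of "(\<one>\<^bsub>B\<^esub>, a)"] that
    by (simp add: semidirect_simps closed A.act_one star_circ_one)
  have circ_one: "circ b \<one>\<^bsub>A\<^esub> = \<one>\<^bsub>A\<^esub>" if "b \<in> carrier B" for b
    using star_circ_one[OF that] that by (simp add: star_one closed)
  have one_circ: "circ \<one>\<^bsub>B\<^esub> a = \<one>\<^bsub>A\<^esub>" if "a \<in> carrier A" for a
    using E.one_act[of "(\<one>\<^bsub>B\<^esub>, a)"] that
    by (simp add: semidirect_simps closed A.one_act star_one)
  define i where "i a = (\<one>\<^bsub>B\<^esub>, a)" for a :: 'a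
  define j where "j b = (b, \<one>\<^bsub>A\<^esub>)" for b :: 'b
  note simps = semidirect_simps closed one_dot dot_one star_one circ_one one_circ star_unit
    A.act_one A.one_act B.act_one B.one_act
  have "split_extension A ?E B i fst j"
  proof unfold_locales
    show "i \<in> gract_hom A ?E"
      by (auto simp: gract_hom_def hom_def i_def simps)
    show "fst \<in> gract_hom ?E B"
      by (auto simp: gract_hom_def hom_def simps)
    show "j \<in> gract_hom B ?E"
      by (auto simp: gract_hom_def hom_def j_def simps)
    show "inj_on i (carrier A)"
      by (auto simp: inj_on_def i_def)
    show "i ` carrier A = kernel ?E B fst"
      by (auto simp: kernel_def i_def simps)
    show "fst ` carrier ?E = carrier B"
      by (force simp: simps)
    show "fst (j b) = b" for b
      by (simp add: j_def)
  qed
  moreover have "induces_actions A ?E B i j dot star circ"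
    unfolding induces_actions_def
  proof (intro ballI conjI)
    fix b a assume ab: "b \<in> carrier B" "a \<in> carrier A"
    have ij: "i x \<in> carrier ?E" "j b \<in> carrier ?E" if "x \<in> carrier A" for x
      using ab that by (simp_all add: i_def j_def simps)
    have "i (dot b a) \<otimes>\<^bsub>?E\<^esub> j b = j b \<otimes>\<^bsub>?E\<^esub> i a"
      using ab by (simp add: i_def j_def simps)
    then show "i (dot b a) = j b \<otimes>\<^bsub>?E\<^esub> i a \<otimes>\<^bsub>?E\<^esub> inv\<^bsub>?E\<^esub> j b"
      using ab by (intro E.inv_solve_right[THEN iffD2]) (simp_all add: ij closed)
    have "i (circ b a) \<otimes>\<^bsub>?E\<^esub> j b = j b \<up>\<^bsub>?E\<^esub> i a"
      using ab by (simp add: i_def j_def simps)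
    then show "i (circ b a) = (j b \<up>\<^bsub>?E\<^esub> i a) \<otimes>\<^bsub>?E\<^esub> inv\<^bsub>?E\<^esub> j b"
      using ab by (intro E.inv_solve_right[THEN iffD2]) (simp_all add: ij closed E.act_closed)
    show "i (star b a) = i a \<up>\<^bsub>?E\<^esub> j b"
      using ab by (simp add: i_def j_def simps)
  qed
  ultimately show ?thesis
    unfolding derived_actions_def by blast
qed

section \<open>The equivalence\<close>

theorem theorem4p2:
  fixes A :: "('a, 'm) gract_scheme" and B :: "('b, 'n) gract_scheme"
    and dot star circ :: "'b \<Rightarrow> 'a \<Rightarrow> 'a"
  assumes "reduced_group_with_action A"
    and "reduced_group_with_action B"
    and "action_triple A B dot star circ"
  shows "(derived_actions A B dot star circ \<longleftrightarrow> derived_action_conditions A B dot star circ) \<and>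
         (derived_action_conditions A B dot star circ \<longleftrightarrow>
            reduced_group_with_action (semidirect A B dot star circ) \<and>
            (\<forall>b \<in> carrier B. star b \<one>\<^bsub>A\<^esub> = \<one>\<^bsub>A\<^esub>))"
proof -
  have "derived_action_conditions A B dot star circ" if "derived_actions A B dot star circ"
    using that split_extension_conditions assms(3) unfolding derived_actions_def by blast
  moreover note conditions_semidirect[OF assms] semidirect_derived_actions[OF assms]
  ultimately show ?thesis
    by blast
qed

end
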